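(* Every totally ordered division ring is po-coherent.
   Context: Rings are associative and unital. A po-ring is a ring $R$ with a partial ordering $\leq$ such that: $x\leq y$ implies $x+z\leq y+z$, and, if $z\geq 0$, also $xz\leq yz$ and $zx\leq zy$; $R$ is directed, i.e. $R=R^++(-R^+)$ where $R^+=\{x\in R: x\geq 0\}$; and $0\leq 1$. Every totally ordered ring is a po-ring. A right $R^+$-subsemimodule of a right $R$-module is an additive submonoid closed under right multiplication by scalars in $R^+$; it is finitely generated if it consists of all right linear combinations, with coefficients in $R^+$, of some finite subset of itself. A po-ring $R$ is right po-coherent if for every integer $n\geq 1$ and every $1\times n$ row matrix $U$ with entries in $R$, the set of all $n\times 1$ column matrices $X$ with entries in $R$ such that $UX\geq 0$ and $X\geq 0$ (entrywise) is a finitely generated right $R^+$-subsemimodule of the right $R$-module of $n\times 1$ columns over $R$. Left po-coherence is defined symmetrically (rows and columns, left and right exchanged), and $R$ is po-coherent if it is both right and left po-coherent. A division ring need not be commutative. *)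

theory Defs
  imports "Jordan_Normal_Form.Matrix"
begin

section \<open>Partially and totally ordered rings\<close>

text \<open>Built on \<^class>\<open>monoid_mult\<close> instead of \<^class>\<open>ring_1\<close> so that the zero ring is allowed.
  Compatibility of the order with addition and with multiplication by nonnegative elements on both
  sides is part of \<^class>\<open>ordered_ring\<close>.\<close>

class po_ring = ordered_ring + monoid_mult +
  assumes zero_le_one': "0 \<le> 1"
    and directed: "\<exists>a b. 0 \<le> a \<and> 0 \<le> b \<and> x = a - b"

class totally_ordered_ring = ordered_ring + monoid_mult + linorder
begin

subclass po_ring
proof
  show "0 \<le> 1"
  proof (rule ccontr)
    assume neg: "\<not> 0 \<le> 1"
    then have "1 \<le> 0" by simp
    then have "0 \<le> 1 * 1" by (intro mult_nonpos_nonpos)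
    with neg show False by simp
  qed
  show "\<exists>a b. 0 \<le> a \<and> 0 \<le> b \<and> x = a - b" for x
  proof (cases "0 \<le> x")
    case True
    then show ?thesis by (intro exI[of _ x] exI[of _ 0]) simp
  next
    case False
    then show ?thesis by (intro exI[of _ 0] exI[of _ "- x"]) simp
  qed
qed

end

class totally_ordered_division_ring = totally_ordered_ring + division_ring


section \<open>Finitely generated subsemimodules of matrix modules\<close>

text \<open>The library's \<open>r \<cdot>\<^sub>m X\<close> is multiplication by a scalar from the left; the ring need not be
  commutative, so right multiplication is a separate operation.\<close>

definition smult_mat_right :: "'a :: times mat \<Rightarrow> 'a \<Rightarrow> 'a mat" where
  "smult_mat_right X r = map_mat (\<lambda>x. x * r) X"

definition right_subsemimodule :: "nat \<Rightarrow> nat \<Rightarrow> 'a :: po_ring mat set \<Rightarrow> bool" where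
  "right_subsemimodule m n M \<longleftrightarrow>
     M \<subseteq> carrier_mat m n \<and> 0\<^sub>m m n \<in> M \<and>
     (\<forall>X\<in>M. \<forall>Y\<in>M. X + Y \<in> M) \<and>
     (\<forall>X\<in>M. \<forall>r\<ge>0. smult_mat_right X r \<in> M)"

definition left_subsemimodule :: "nat \<Rightarrow> nat \<Rightarrow> 'a :: po_ring mat set \<Rightarrow> bool" where
  "left_subsemimodule m n M \<longleftrightarrow>
     M \<subseteq> carrier_mat m n \<and> 0\<^sub>m m n \<in> M \<and>
     (\<forall>X\<in>M. \<forall>Y\<in>M. X + Y \<in> M) \<and>
     (\<forall>X\<in>M. \<forall>r\<ge>0. r \<cdot>\<^sub>m X \<in> M)"

text \<open>The linear combinations \<open>\<Sum>X\<in>S. X c\<^sub>X\<close>, respectively \<open>\<Sum>X\<in>S. c\<^sub>X X\<close>, of a finite set \<open>S\<close> with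
  nonnegative coefficients. The sum is taken entrywise because \<open>m \<times> n\<close> matrices do not form a type
  with a zero.\<close>

definition right_combinations :: "nat \<Rightarrow> nat \<Rightarrow> 'a :: po_ring mat set \<Rightarrow> 'a mat set" where
  "right_combinations m n S =
     {mat m n (\<lambda>ij. \<Sum>X\<in>S. smult_mat_right X (c X) $$ ij) | c. \<forall>X\<in>S. 0 \<le> c X}"

definition left_combinations :: "nat \<Rightarrow> nat \<Rightarrow> 'a :: po_ring mat set \<Rightarrow> 'a mat set" where
  "left_combinations m n S =
     {mat m n (\<lambda>ij. \<Sum>X\<in>S. (c X \<cdot>\<^sub>m X) $$ ij) | c. \<forall>X\<in>S. 0 \<le> c X}"

definition fin_gen_right_subsemimodule :: "nat \<Rightarrow> nat \<Rightarrow> 'a :: po_ring mat set \<Rightarrow> bool" where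
  "fin_gen_right_subsemimodule m n M \<longleftrightarrow>
     right_subsemimodule m n M \<and> (\<exists>S\<subseteq>M. finite S \<and> M = right_combinations m n S)"

definition fin_gen_left_subsemimodule :: "nat \<Rightarrow> nat \<Rightarrow> 'a :: po_ring mat set \<Rightarrow> bool" where
  "fin_gen_left_subsemimodule m n M \<longleftrightarrow>
     left_subsemimodule m n M \<and> (\<exists>S\<subseteq>M. finite S \<and> M = left_combinations m n S)"


section \<open>Po-coherence\<close>

text \<open>The library's order on matrices is the entrywise one.\<close>

definition right_po_coherent :: "'a :: po_ring itself \<Rightarrow> bool" where
  "right_po_coherent _ \<longleftrightarrow>
     (\<forall>n\<ge>1. \<forall>U \<in> carrier_mat 1 n. fin_gen_right_subsemimodule n 1
        {X :: 'a mat. X \<in> carrier_mat n 1 \<and> 0\<^sub>m 1 1 \<le> U * X \<and> 0\<^sub>m n 1 \<le> X})"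

definition left_po_coherent :: "'a :: po_ring itself \<Rightarrow> bool" where
  "left_po_coherent _ \<longleftrightarrow>
     (\<forall>n\<ge>1. \<forall>U \<in> carrier_mat n 1. fin_gen_left_subsemimodule 1 n
        {X :: 'a mat. X \<in> carrier_mat 1 n \<and> 0\<^sub>m 1 1 \<le> X * U \<and> 0\<^sub>m 1 n \<le> X})"

definition po_coherent :: "'a :: po_ring itself \<Rightarrow> bool" where
  "po_coherent T \<longleftrightarrow> right_po_coherent T \<and> left_po_coherent T"

end

theory Submission
  imports Defs
begin

text \<open>Over a totally ordered division ring the cone of all \<open>x \<ge> 0\<close> with \<open>\<Sum>\<^sub>k u\<^sub>k x\<^sub>k \<ge> 0\<close> is generated
  by the unit vectors \<open>e\<^sub>i\<close> with \<open>u\<^sub>i \<ge> 0\<close> and the vectors \<open>e\<^sub>i u\<^sub>i\<^sup>-\<^sup>1 + e\<^sub>j (- u\<^sub>j)\<^sup>-\<^sup>1\<close> with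
  \<open>u\<^sub>i > 0 > u\<^sub>j\<close>. Indeed, let \<open>s\<close> and \<open>- t\<close> be the sums of the positive and of the negative
  terms \<open>u\<^sub>k x\<^sub>k\<close>, so that \<open>t \<le> s\<close>. Giving the \<open>(i, j)\<close> generator the coefficient
  \<open>(u\<^sub>i x\<^sub>i) s\<^sup>-\<^sup>1 (- u\<^sub>j x\<^sub>j)\<close> accounts for all of \<open>x\<^sub>j\<close> and for the part \<open>x\<^sub>i s\<^sup>-\<^sup>1 t\<close> of \<open>x\<^sub>i\<close>, and
  the remainder \<open>x\<^sub>i (1 - s\<^sup>-\<^sup>1 t)\<close> is nonnegative. The case \<open>s = 0\<close> forces \<open>t = 0\<close>, and
  is consistent with these formulas because \<open>inverse 0 = 0\<close>.\<close>

text \<open>A negative inverse would give \<open>1 = x * inverse x \<le> 0\<close>. The value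
  \<open>x = 0\<close> is covered because \<open>inverse 0 = 0\<close>.\<close>

lemma inverse_nonneg:
  fixes x :: "'a :: totally_ordered_division_ring"
  assumes "0 \<le> x"
  shows "0 \<le> inverse x"
proof (rule ccontr)
  assume neg: "\<not> 0 \<le> inverse x"
  then have "x \<noteq> 0" by auto
  moreover have "x * inverse x \<le> 0"
    using assms neg by (intro mult_nonneg_nonpos) auto
  ultimately have "(1 :: 'a) \<le> 0" by simp
  with zero_le_one' show False
    using order.antisym zero_neq_one by metis
qed

text \<open>The two cases let the left and the right half of the theorem share one argument.\<close>

locale one_sided_mult =
  fixes m :: "'a :: totally_ordered_division_ring \<Rightarrow> 'a \<Rightarrow> 'a" (infixl "\<star>" 70)
  assumes side: "m = (\<lambda>x y. x * y) \<or> m = (\<lambda>x y. y * x)"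
begin

section \<open>Laws of the product valid on either side\<close>

lemma m_assoc: "a \<star> b \<star> c = a \<star> (b \<star> c)"
  using side by (auto simp: mult.assoc)

lemma m_zero [simp]: "0 \<star> a = 0" "a \<star> 0 = 0"
  using side by auto

lemma m_one [simp]: "1 \<star> a = a" "a \<star> 1 = a"
  using side by auto

lemma m_minus [simp]: "(- a) \<star> b = - (a \<star> b)" "a \<star> (- b) = - (a \<star> b)"
  using side by auto

lemma m_distrib: "(a + b) \<star> c = a \<star> c + b \<star> c" "a \<star> (b - c) = a \<star> b - a \<star> c"
    "a \<star> (b + c) = a \<star> b + a \<star> c"
  using side by (auto simp: algebra_simps)

lemma m_nonneg: "0 \<le> a \<Longrightarrow> 0 \<le> b \<Longrightarrow> 0 \<le> a \<star> b"
  using side by auto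

lemma m_inverse: "a \<noteq> 0 \<Longrightarrow> a \<star> inverse a = 1" "a \<noteq> 0 \<Longrightarrow> inverse a \<star> a = 1"
  using side by auto

lemma m_sum: "sum f A \<star> a = (\<Sum>i\<in>A. f i \<star> a)" "a \<star> sum f A = (\<Sum>i\<in>A. a \<star> f i)"
  using side by (auto simp: sum_distrib_left sum_distrib_right)

text \<open>Moves factors into a conditional, so that sums against unit vectors collapse to a single
  term.\<close>

lemma m_if: "(if P then a else 0) \<star> b = (if P then a \<star> b else 0)"
    "b \<star> (if P then a else 0) = (if P then b \<star> a else 0)"
  by simp_all

section \<open>The cone and its generators\<close>

definition in_cone :: "nat \<Rightarrow> (nat \<Rightarrow> 'a) \<Rightarrow> (nat \<Rightarrow> 'a) \<Rightarrow> bool" where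
  "in_cone n u x \<longleftrightarrow> (\<forall>k<n. 0 \<le> x k) \<and> 0 \<le> (\<Sum>k<n. u k \<star> x k)"

text \<open>The two conditionals are added, not nested, so that sums over \<open>k\<close> split by
  distributivity. For indices in \<open>gen_index\<close> the signs of \<open>u i\<close> and
  \<open>u j\<close> differ, hence the two entries never overlap.\<close>

fun gen :: "(nat \<Rightarrow> 'a) \<Rightarrow> nat + nat \<times> nat \<Rightarrow> nat \<Rightarrow> 'a" where
  "gen u (Inl i) k = (if k = i then 1 else 0)"
| "gen u (Inr (i, j)) k = (if k = i then inverse (u i) else 0) + (if k = j then inverse (- u j) else 0)"

definition gen_index :: "nat \<Rightarrow> (nat \<Rightarrow> 'a) \<Rightarrow> (nat + nat \<times> nat) set" where
  "gen_index n u = {i. i < n \<and> 0 \<le> u i} <+> {i. i < n \<and> 0 < u i} \<times> {j. j < n \<and> u j < 0}"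

lemma finite_gen_index: "finite (gen_index n u)"
  by (auto simp: gen_index_def)

lemma gen_in_cone:
  assumes "a \<in> gen_index n u"
  shows "in_cone n u (gen u a)"
proof (cases a)
  case (Inl i)
  with assms have i: "i < n" "0 \<le> u i" by (auto simp: gen_index_def)
  then have "(\<Sum>k<n. u k \<star> gen u a k) = u i"
    by (simp add: Inl m_if)
  then show ?thesis
    using i zero_le_one' by (auto simp: in_cone_def Inl)
next
  case (Inr p)
  then obtain i j where a: "a = Inr (i, j)" by (cases p) auto
  with assms have i: "i < n" "0 < u i" and j: "j < n" "u j < 0"
    by (auto simp: gen_index_def)
  \<comment> \<open>The two nonzero entries contribute 1 and -1, so a mixed generator lies on the
    bounding hyperplane.\<close>
  have "(\<Sum>k<n. u k \<star> gen u a k) = u i \<star> inverse (u i) + u j \<star> inverse (- u j)"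
    using i j by (simp add: a m_distrib m_if sum.distrib)
  also have "\<dots> = 0"
    using i j m_inverse(1)[of "u i"] m_inverse(1)[of "u j"]
    by simp
  finally have "(\<Sum>k<n. u k \<star> gen u a k) = 0" .
  moreover have "0 \<le> gen u a k" for k
    using i j inverse_nonneg[of "u i"] inverse_nonneg[of "- u j"]
    unfolding a gen.simps by (intro add_nonneg_nonneg) auto
  ultimately show ?thesis by (simp add: in_cone_def)
qed

lemma cone_generated:
  assumes "in_cone n u x"
  obtains c where "\<And>a. a \<in> gen_index n u \<Longrightarrow> 0 \<le> c a"
    and "\<And>k. k < n \<Longrightarrow> x k = (\<Sum>a\<in>gen_index n u. gen u a k \<star> c a)"
proof -
  define P where "P = {i. i < n \<and> 0 < u i}"
  define N where "N = {j. j < n \<and> u j < 0}"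
  define w where "w = (\<lambda>j. (- u j) \<star> x j)"
  define s where "s = (\<Sum>i\<in>P. u i \<star> x i)"
  define t where "t = (\<Sum>j\<in>N. w j)"
  have fin [simp]: "finite P" "finite N" by (auto simp: P_def N_def)
  have x: "0 \<le> x k" if "k < n" for k
    using assms that by (simp add: in_cone_def)
  have w: "0 \<le> w j" if "j \<in> N" for j
    unfolding w_def using that x by (intro m_nonneg) (auto simp: N_def)
  have s: "0 \<le> s"
    unfolding s_def using x by (intro sum_nonneg m_nonneg) (auto simp: P_def)
  have t: "0 \<le> t"
    unfolding t_def using w by (intro sum_nonneg)
  have "(\<Sum>k<n. u k \<star> x k) = (\<Sum>k\<in>P \<union> N. u k \<star> x k)"
    by (rule sum.mono_neutral_right) (auto simp: P_def N_def not_less_iff_gr_or_eq)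
  also have "\<dots> = s - t"
    unfolding s_def t_def w_def
    by (subst sum.union_disjoint) (auto simp: P_def N_def sum_negf)
  finally have ts: "t \<le> s"
    using assms by (simp add: in_cone_def)
  \<comment> \<open>Cancellation of \<open>s\<close> survives \<open>s = 0\<close>: then
    \<open>t = 0\<close>, and each \<open>w j\<close>, a nonnegative summand of \<open>t\<close>,
    vanishes.\<close>
  have sw: "s \<star> (inverse s \<star> w j) = w j" if j: "j \<in> N" for j
  proof (cases "s = 0")
    case True
    with ts t have "t = 0" by simp
    then have "w j = 0"
      using j w by (simp add: t_def sum_nonneg_eq_0_iff)
    then show ?thesis by simp
  next
    case False
    then show ?thesis by (simp add: m_assoc[symmetric] m_inverse)
  qed
  \<comment> \<open>For \<open>s \<noteq> 0\<close> this is
    \<open>inverse s \<star> (s - t)\<close>; for \<open>s = 0\<close> the default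
    \<open>inverse 0 = 0\<close> leaves 1.\<close>
  have rest: "0 \<le> 1 - inverse s \<star> t"
  proof (cases "s = 0")
    case True
    then show ?thesis using zero_le_one' by simp
  next
    case False
    have "0 \<le> inverse s \<star> (s - t)"
      using s ts by (intro m_nonneg inverse_nonneg) auto
    with False show ?thesis by (simp add: m_distrib m_inverse)
  qed
  \<comment> \<open>For \<open>u i = 0\<close> no mixed generator touches coordinate
    \<open>i\<close>, so the unit vector carries all of \<open>x i\<close>.\<close>
  define d where "d = (\<lambda>i. if 0 < u i then x i \<star> (1 - inverse s \<star> t) else x i)"
  \<comment> \<open>A transport plan from the supplies \<open>u i \<star> x i\<close> to the demands
    \<open>w j\<close>. With \<open>inverse s\<close> in the middle, summing over \<open>i\<close>
    forms \<open>s\<close> on one side and summing over \<open>j\<close> forms \<open>t\<close> on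
    the other, without commuting any factors.\<close>
  define e where "e = (\<lambda>i j. (u i \<star> x i) \<star> (inverse s \<star> w j))"
  define c where "c = case_sum d (\<lambda>(i, j). e i j)"
  have "0 \<le> c a" if "a \<in> gen_index n u" for a
    using that x w s rest
    by (auto simp: gen_index_def c_def d_def e_def P_def N_def intro!: m_nonneg inverse_nonneg)
  moreover have "x k = (\<Sum>a\<in>gen_index n u. gen u a k \<star> c a)" if k: "k < n" for k
  proof -
    have row: "(\<Sum>j\<in>N. e k j) = (u k \<star> x k) \<star> (inverse s \<star> t)"
      by (simp add: e_def t_def m_sum)
    have col: "(\<Sum>i\<in>P. e i k) = w k" if "k \<in> N"
      using sw[OF that] by (simp add: e_def s_def m_sum(1))
    have "(\<Sum>a\<in>gen_index n u. gen u a k \<star> c a) =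
        (\<Sum>i\<in>{i. i < n \<and> 0 \<le> u i}. gen u (Inl i) k \<star> d i) +
        (\<Sum>(i, j)\<in>P \<times> N. gen u (Inr (i, j)) k \<star> e i j)"
      by (simp add: gen_index_def sum.Plus c_def P_def N_def o_def case_prod_unfold del: gen.simps)
    also have "(\<Sum>i\<in>{i. i < n \<and> 0 \<le> u i}. gen u (Inl i) k \<star> d i) = (if 0 \<le> u k then d k else 0)"
      using k by (simp add: m_if)
    also have "(\<Sum>(i, j)\<in>P \<times> N. gen u (Inr (i, j)) k \<star> e i j) =
        (\<Sum>i\<in>P. \<Sum>j\<in>N. if k = i then inverse (u i) \<star> e i j else 0) +
        (\<Sum>i\<in>P. \<Sum>j\<in>N. if k = j then inverse (- u j) \<star> e i j else 0)"
      by (simp add: sum.cartesian_product[symmetric] m_distrib m_if sum.distrib del: inverse_minus_eq)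
    \<comment> \<open>Exchanging the sums puts the conditional on \<open>i\<close> innermost, where
      it collapses.\<close>
    also have "(\<Sum>i\<in>P. \<Sum>j\<in>N. if k = i then inverse (u i) \<star> e i j else 0) =
        (if k \<in> P then inverse (u k) \<star> (\<Sum>j\<in>N. e k j) else 0)"
      by (subst sum.swap) (simp add: m_sum)
    also have "\<dots> = (if k \<in> P then x k \<star> (inverse s \<star> t) else 0)"
      by (auto simp: row m_assoc[symmetric] m_inverse P_def)
    also have "(\<Sum>i\<in>P. \<Sum>j\<in>N. if k = j then inverse (- u j) \<star> e i j else 0) =
        (if k \<in> N then inverse (- u k) \<star> (\<Sum>i\<in>P. e i k) else 0)"
      by (simp add: m_sum del: inverse_minus_eq)
    also have "\<dots> = (if k \<in> N then x k else 0)"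
      by (auto simp: col w_def m_assoc[symmetric] m_inverse N_def)
    \<comment> \<open>By the sign of \<open>u k\<close>: if positive, \<open>d k\<close> and the row
      share add up to \<open>x k\<close>; if zero, \<open>d k\<close> is \<open>x k\<close>; if
      negative, only the column share \<open>x k\<close> is present.\<close>
    finally show ?thesis
      using k by (auto simp: d_def P_def N_def m_distrib not_le)
  qed
  ultimately show thesis by (rule that)
qed

text \<open>A combination has one coefficient per matrix of a set, whereas the generators form an
  indexed family. Coefficients of indices with the same image are added up, whether or not the
  family is injective; \<open>f\<close> reads the entries that \<open>h\<close> stores.\<close>

lemma cone_generated_image:
  fixes h :: "(nat \<Rightarrow> 'a) \<Rightarrow> 'b" and f :: "'b \<Rightarrow> nat \<Rightarrow> 'a"
  assumes "in_cone n u x" and f: "\<And>y k. k < n \<Longrightarrow> f (h y) k = y k"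
  obtains c where "\<And>X. X \<in> (\<lambda>a. h (gen u a)) ` gen_index n u \<Longrightarrow> 0 \<le> c X"
    and "\<And>k. k < n \<Longrightarrow> x k = (\<Sum>X\<in>(\<lambda>a. h (gen u a)) ` gen_index n u. f X k \<star> c X)"
proof -
  obtain c where c: "\<And>a. a \<in> gen_index n u \<Longrightarrow> 0 \<le> c a"
    and x: "\<And>k. k < n \<Longrightarrow> x k = (\<Sum>a\<in>gen_index n u. gen u a k \<star> c a)"
    using cone_generated[OF assms(1)] by blast
  define c' where "c' X = (\<Sum>a\<in>{a. a \<in> gen_index n u \<and> h (gen u a) = X}. c a)" for X
  have "0 \<le> c' X" for X
    unfolding c'_def using c by (intro sum_nonneg) auto
  moreover have "x k = (\<Sum>X\<in>(\<lambda>a. h (gen u a)) ` gen_index n u. f X k \<star> c' X)" if k: "k < n" for k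
  proof -
    have "x k = (\<Sum>X\<in>(\<lambda>a. h (gen u a)) ` gen_index n u.
        \<Sum>a\<in>{a. a \<in> gen_index n u \<and> h (gen u a) = X}. gen u a k \<star> c a)"
      unfolding x[OF k] by (rule sum.image_gen) (rule finite_gen_index)
    also have "\<dots> = (\<Sum>X\<in>(\<lambda>a. h (gen u a)) ` gen_index n u. f X k \<star> c' X)"
    proof (rule sum.cong[OF refl])
      fix X
      have "gen u a k = f X k" if "h (gen u a) = X" for a
        using f[OF k, of "gen u a"] that by simp
      then show "(\<Sum>a\<in>{a. a \<in> gen_index n u \<and> h (gen u a) = X}. gen u a k \<star> c a) = f X k \<star> c' X"
        by (simp add: c'_def m_sum)
    qed
    finally show ?thesis .
  qed
  ultimately show thesis by (rule that)
qed

section \<open>Closure of the cone under the module operations\<close>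

lemma cone_zero: "in_cone n u (\<lambda>_. 0)"
  by (simp add: in_cone_def)

lemma cone_add: "in_cone n u x \<Longrightarrow> in_cone n u y \<Longrightarrow> in_cone n u (\<lambda>k. x k + y k)"
  by (simp add: in_cone_def m_distrib sum.distrib)

text \<open>The scalar acts on the side away from \<open>u\<close>, so associativity pulls it out of
  the sum.\<close>

lemma cone_smult:
  assumes "in_cone n u x" "0 \<le> r"
  shows "in_cone n u (\<lambda>k. x k \<star> r)"
proof -
  have "(\<Sum>k<n. u k \<star> (x k \<star> r)) = (\<Sum>k<n. u k \<star> x k) \<star> r"
    by (simp add: m_sum m_assoc)
  with assms show ?thesis by (simp add: in_cone_def m_nonneg)
qed

text \<open>As a congruence rule it supplies the bound \<open>k < n\<close> under which matrix
  entries can be evaluated.\<close>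

lemma cone_cong: "(\<And>k. k < n \<Longrightarrow> x k = y k) \<Longrightarrow> in_cone n u x \<longleftrightarrow> in_cone n u y"
  by (auto simp: in_cone_def)

end

section \<open>Combinations of elements stay in a subsemimodule\<close>

lemma right_combinations_subset:
  fixes M :: "'a :: po_ring mat set"
  assumes M: "right_subsemimodule m n M" and "finite S" "S \<subseteq> M"
  shows "right_combinations m n S \<subseteq> M"
proof -
  have "(\<forall>X\<in>S. 0 \<le> c X) \<Longrightarrow> mat m n (\<lambda>ij. \<Sum>X\<in>S. smult_mat_right X (c X) $$ ij) \<in> M" for c
    using assms(2,3)
  proof (induction S)
    case empty
    have "mat m n (\<lambda>_. 0 :: 'a) = 0\<^sub>m m n" by auto
    with M show ?case by (simp add: right_subsemimodule_def)
  next
    case (insert X S)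
    let ?Y = "mat m n (\<lambda>ij. \<Sum>X\<in>S. smult_mat_right X (c X) $$ ij)"
    have "X \<in> carrier_mat m n"
      using M insert.prems by (auto simp: right_subsemimodule_def)
    then have "mat m n (\<lambda>ij. \<Sum>X\<in>insert X S. smult_mat_right X (c X) $$ ij) =
        smult_mat_right X (c X) + ?Y"
      using insert.hyps by (intro eq_matI) (auto simp: smult_mat_right_def)
    then show ?case
      using M insert by (simp add: right_subsemimodule_def)
  qed
  then show ?thesis by (auto simp: right_combinations_def)
qed

lemma left_combinations_subset:
  fixes M :: "'a :: po_ring mat set"
  assumes M: "left_subsemimodule m n M" and "finite S" "S \<subseteq> M"
  shows "left_combinations m n S \<subseteq> M"
proof -
  have "(\<forall>X\<in>S. 0 \<le> c X) \<Longrightarrow> mat m n (\<lambda>ij. \<Sum>X\<in>S. (c X \<cdot>\<^sub>m X) $$ ij) \<in> M" for c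
    using assms(2,3)
  proof (induction S)
    case empty
    have "mat m n (\<lambda>_. 0 :: 'a) = 0\<^sub>m m n" by auto
    with M show ?case by (simp add: left_subsemimodule_def)
  next
    case (insert X S)
    let ?Y = "mat m n (\<lambda>ij. \<Sum>X\<in>S. (c X \<cdot>\<^sub>m X) $$ ij)"
    have "X \<in> carrier_mat m n"
      using M insert.prems by (auto simp: left_subsemimodule_def)
    then have "mat m n (\<lambda>ij. \<Sum>X\<in>insert X S. (c X \<cdot>\<^sub>m X) $$ ij) = c X \<cdot>\<^sub>m X + ?Y"
      using insert.hyps by (intro eq_matI) auto
    then show ?case
      using M insert by (simp add: left_subsemimodule_def)
  qed
  then show ?thesis by (auto simp: left_combinations_def)
qed

section \<open>From the cone to columns and rows\<close>

lemma right_po_coherent_division_ring: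
  "right_po_coherent TYPE('a :: totally_ordered_division_ring)"
  unfolding right_po_coherent_def
proof (intro allI impI ballI)
  fix n :: nat and U :: "'a mat"
  assume U: "U \<in> carrier_mat 1 n"
  interpret one_sided_mult "\<lambda>x y :: 'a. x * y" by unfold_locales simp
  define M where "M = {X. X \<in> carrier_mat n 1 \<and> 0\<^sub>m 1 1 \<le> U * X \<and> 0\<^sub>m n 1 \<le> X}"
  define u where "u = (\<lambda>k. U $$ (0, k))"
  define h where "h = (\<lambda>x :: nat \<Rightarrow> 'a. mat n 1 (\<lambda>(k, _). x k))"
  define S where "S = (\<lambda>a. h (gen u a)) ` gen_index n u"
  \<comment> \<open>The single entry of \<open>U * X\<close> is the sum in \<open>in_cone\<close>,
    so both entrywise inequalities become cone membership.\<close>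
  have M_iff: "X \<in> M \<longleftrightarrow> X \<in> carrier_mat n 1 \<and> in_cone n u (\<lambda>k. X $$ (k, 0))" for X
  proof (cases "X \<in> carrier_mat n 1")
    case True
    with U have "dim_row X = n" "dim_col X = 1" "dim_row U = 1" "dim_col U = n" by auto
    with True show ?thesis
      by (auto simp: M_def less_eq_mat_def in_cone_def scalar_prod_def u_def atLeast0LessThan)
  qed (simp add: M_def)
  have M: "right_subsemimodule n 1 M"
    unfolding right_subsemimodule_def
  proof (intro conjI ballI allI impI)
    show "0\<^sub>m n 1 \<in> M"
      using cone_zero by (simp add: M_iff cong: cone_cong)
    show "X + Y \<in> M" if "X \<in> M" "Y \<in> M" for X Y
      using that cone_add[of n u "\<lambda>k. X $$ (k, 0)" "\<lambda>k. Y $$ (k, 0)"]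
      by (auto simp: M_iff cong: cone_cong)
    show "smult_mat_right X r \<in> M" if "X \<in> M" "0 \<le> r" for X r
      using that cone_smult[of n u "\<lambda>k. X $$ (k, 0)" r]
      by (auto simp: M_iff smult_mat_right_def cong: cone_cong)
  qed (auto simp: M_iff)
  have "S \<subseteq> M"
    using gen_in_cone[of _ n u] by (auto simp: S_def M_iff h_def cong: cone_cong)
  have "finite S"
    by (simp add: S_def finite_gen_index)
  have dim: "dim_row Y = n" "dim_col Y = 1" if "Y \<in> S" for Y
    using that by (auto simp: S_def h_def)
  have "M \<subseteq> right_combinations n 1 S"
  proof
    fix X assume X: "X \<in> M"
    obtain c where c: "\<And>Y. Y \<in> S \<Longrightarrow> 0 \<le> c Y"
      and x: "\<And>k. k < n \<Longrightarrow> X $$ (k, 0) = (\<Sum>Y\<in>S. Y $$ (k, 0) * c Y)"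
      using cone_generated_image[of n u "\<lambda>k. X $$ (k, 0)" "\<lambda>Y k. Y $$ (k, 0)" h] X
      by (auto simp: M_iff S_def h_def)
    have "X = mat n 1 (\<lambda>ij. \<Sum>Y\<in>S. smult_mat_right Y (c Y) $$ ij)"
      using X dim by (intro eq_matI) (auto simp: M_iff x smult_mat_right_def intro!: sum.cong)
    with c show "X \<in> right_combinations n 1 S"
      by (auto simp: right_combinations_def)
  qed
  \<comment> \<open>The other inclusion holds for every finite subset of a subsemimodule.\<close>
  with M \<open>S \<subseteq> M\<close> \<open>finite S\<close> show "fin_gen_right_subsemimodule n 1 M"
    using right_combinations_subset[OF M, of S]
    unfolding fin_gen_right_subsemimodule_def by blast
qed

lemma left_po_coherent_division_ring:
  "left_po_coherent TYPE('a :: totally_ordered_division_ring)"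
  unfolding left_po_coherent_def
proof (intro allI impI ballI)
  fix n :: nat and U :: "'a mat"
  assume U: "U \<in> carrier_mat n 1"
  \<comment> \<open>The reversed product turns \<open>u k \<star> x k\<close> into
    \<open>x k * u k\<close>, a term of the entry of \<open>X * U\<close>, and lets coefficients act
    from the left.\<close>
  interpret one_sided_mult "\<lambda>x y :: 'a. y * x" by unfold_locales simp
  define M where "M = {X. X \<in> carrier_mat 1 n \<and> 0\<^sub>m 1 1 \<le> X * U \<and> 0\<^sub>m 1 n \<le> X}"
  define u where "u = (\<lambda>k. U $$ (k, 0))"
  define h where "h = (\<lambda>x :: nat \<Rightarrow> 'a. mat 1 n (\<lambda>(_, k). x k))"
  define S where "S = (\<lambda>a. h (gen u a)) ` gen_index n u"
  have M_iff: "X \<in> M \<longleftrightarrow> X \<in> carrier_mat 1 n \<and> in_cone n u (\<lambda>k. X $$ (0, k))" for X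
  proof (cases "X \<in> carrier_mat 1 n")
    case True
    with U have "dim_row X = 1" "dim_col X = n" "dim_row U = n" "dim_col U = 1" by auto
    with True show ?thesis
      by (auto simp: M_def less_eq_mat_def in_cone_def scalar_prod_def u_def atLeast0LessThan)
  qed (simp add: M_def)
  have M: "left_subsemimodule 1 n M"
    unfolding left_subsemimodule_def
  proof (intro conjI ballI allI impI)
    show "0\<^sub>m 1 n \<in> M"
      using cone_zero by (simp add: M_iff cong: cone_cong)
    show "X + Y \<in> M" if "X \<in> M" "Y \<in> M" for X Y
      using that cone_add[of n u "\<lambda>k. X $$ (0, k)" "\<lambda>k. Y $$ (0, k)"]
      by (auto simp: M_iff cong: cone_cong)
    show "r \<cdot>\<^sub>m X \<in> M" if "X \<in> M" "0 \<le> r" for X r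
      using that cone_smult[of n u "\<lambda>k. X $$ (0, k)" r]
      by (auto simp: M_iff cong: cone_cong)
  qed (auto simp: M_iff)
  have "S \<subseteq> M"
    using gen_in_cone[of _ n u] by (auto simp: S_def M_iff h_def cong: cone_cong)
  have "finite S"
    by (simp add: S_def finite_gen_index)
  have dim: "dim_row Y = 1" "dim_col Y = n" if "Y \<in> S" for Y
    using that by (auto simp: S_def h_def)
  have "M \<subseteq> left_combinations 1 n S"
  proof
    fix X assume X: "X \<in> M"
    obtain c where c: "\<And>Y. Y \<in> S \<Longrightarrow> 0 \<le> c Y"
      and x: "\<And>k. k < n \<Longrightarrow> X $$ (0, k) = (\<Sum>Y\<in>S. c Y * Y $$ (0, k))"
      using cone_generated_image[of n u "\<lambda>k. X $$ (0, k)" "\<lambda>Y k. Y $$ (0, k)" h] X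
      by (auto simp: M_iff S_def h_def)
    have "X = mat 1 n (\<lambda>ij. \<Sum>Y\<in>S. (c Y \<cdot>\<^sub>m Y) $$ ij)"
      using X dim by (intro eq_matI) (auto simp: M_iff x intro!: sum.cong)
    with c show "X \<in> left_combinations 1 n S"
      by (auto simp: left_combinations_def)
  qed
  with M \<open>S \<subseteq> M\<close> \<open>finite S\<close> show "fin_gen_left_subsemimodule 1 n M"
    using left_combinations_subset[OF M, of S]
    unfolding fin_gen_left_subsemimodule_def by blast
qed

theorem corollary7p3:
  shows "po_coherent TYPE('a :: totally_ordered_division_ring)"
  by (simp add: po_coherent_def right_po_coherent_division_ring left_po_coherent_division_ring)

end
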